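(* Let $\ell$ and $m$ be positive integers with $3\nmid\ell$, write $q:=2^m$, and let $a\in\mathbb{F}_q\setminus\mathbb{F}_2$ satisfy $\mathrm{Tr}(1/a)=\mathrm{Tr}(1)$. Let $\Gamma_\ell$ be the set of roots in $\mathbb{F}_{q^3}$ of $X^{2q^\ell+1}+X+a$. Pick $\omega\in\mathbb{F}_4\setminus\mathbb{F}_2$ and $b\in\mathbb{F}_q$ with $b^2+b=a^{-1}+1$. Then $b\notin\mathbb{F}_4$. Put $c:=(b+\omega)/(b+\omega^2)$ and define $\Lambda_0:=\{v+v^{-1}: v\in\mathbb{F}_{q^6},\ v^3=c\}$, $\Lambda_1:=\{(a^{-1}+v+v^{-1})/b^2: v\in\mathbb{F}_{q^6},\ v^3=\omega c\}$, $\Lambda_2:=\{(a^{-1}+v+v^{-1})/(b^2+1): v\in\mathbb{F}_{q^6},\ v^3=\omega^2 c\}$, and $\Lambda:=\Lambda_0\cup\Lambda_1\cup\Lambda_2$. Then $\Lambda_0,\Lambda_1,\Lambda_2$ are pairwise disjoint sets of size $3$, and: (1) if $m\equiv 0\pmod 3$ and $c$ is a cube in $\mathbb{F}_{q^2}$, then $\Gamma_\ell=\Lambda_0$; (2) if $m\equiv 0\pmod 3$ and $c$ is not a cube in $\mathbb{F}_{q^2}$, then $\Gamma_\ell=\Lambda_k$ for the unique $k\in\{1,2\}$ such that $c^{(q^2-1)/3}=\omega^{-k\ell}$; (3) if $m\not\equiv 0\pmod 3$, then there is a unique $k\in\{0,1,2\}$ for which $\omega^k c$ is a cube in $\mathbb{F}_{q^2}$,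 and: if $k=0$ and $\ell\equiv m\pmod 3$ then $\Gamma_\ell=\Lambda_0$; if $k\neq 0$ and $\ell\equiv m\pmod 3$ then $\Gamma_\ell=\Lambda_{3-k}$; if $k=0$ and $\ell\equiv -m\pmod 3$ then $\Gamma_\ell=\Lambda$; if $k\neq0$ and $\ell\equiv -m\pmod 3$ then $\Gamma_\ell=\emptyset$.
   Context: $\mathrm{Tr}$ denotes the trace map from $\mathbb{F}_q$ to $\mathbb{F}_2$. All fields are viewed inside a fixed algebraic closure of $\mathbb{F}_2$. *)

theory Defs
  imports
    "HOL-Library.Z2"
    "HOL-Algebra.Algebraic_Closure_Type"
    "HOL-Number_Theory.Cong"
begin

type_synonym F2bar = "bit alg_closure"

lemma CHAR_bit [simp]: "CHAR(bit) = 2"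
proof (rule CHAR_eq_posI)
  fix n :: nat assume "0 < n" "n < 2"
  then have "n = 1" by simp
  then show "of_nat n \<noteq> (0 :: bit)" by simp
qed simp_all

lemma CHAR_F2bar: "CHAR(F2bar) = 2"
  by simp

text \<open>
  The subfield of order \<open>n\<close> of a fixed field, given as the set of roots of \<open>X^n - X\<close>.
  For \<open>n > 1\<close> it coincides with any subfield having exactly \<open>n\<close> elements
  (\<open>subfield_eq_GF\<close>), and in \<^typ>\<open>F2bar\<close> it is one when \<open>n\<close> is a positive power of 2
  (\<open>subfield_of_order_GF\<close>).
\<close>
definition GF :: "nat \<Rightarrow> 'a :: field set" where
  "GF n = {x. x ^ n = x}"

definition subfield_of_order :: "nat \<Rightarrow> 'a :: field set \<Rightarrow> bool" where
  "subfield_of_order n K \<longleftrightarrow> finite K \<and> card K = n \<and> 0 \<in> K \<and> 1 \<in> K \<and>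
     (\<forall>x\<in>K. \<forall>y\<in>K. x + y \<in> K \<and> x * y \<in> K) \<and> (\<forall>x\<in>K. - x \<in> K \<and> inverse x \<in> K)"

lemma poly_X_pow_minus_X:
  fixes n :: nat
  assumes "n > 1"
  defines "p \<equiv> monom (1 :: 'a :: field) n - [:0, 1:]"
  shows "p \<noteq> 0" "degree p = n" "{x. poly p x = 0} = GF n"
proof -
  have "degree [:0, 1 :: 'a:] < degree (monom (1 :: 'a) n)"
    using assms(1) by (simp add: degree_monom_eq)
  then show "degree p = n"
    unfolding p_def diff_conv_add_uminus
    by (subst degree_add_eq_left) (simp_all add: degree_monom_eq)
  with assms(1) show "p \<noteq> 0" by auto
  show "{x. poly p x = 0} = GF n"
    by (auto simp: p_def GF_def poly_monom)
qed

lemma subfield_eq_GF: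
  fixes K :: "'a :: field set"
  assumes "n > 1" "subfield_of_order n K"
  shows "K = GF n"
proof -
  have K: "finite K" "card K = n" "0 \<in> K" "\<And>x y. x \<in> K \<Longrightarrow> y \<in> K \<Longrightarrow> x * y \<in> K"
    using assms(2) by (auto simp: subfield_of_order_def)
  have "x ^ n = x" if x: "x \<in> K" "x \<noteq> 0" for x
  proof -
    let ?U = "K - {0}"
    have inj: "inj_on ((*) x) ?U"
      using x by (auto intro!: inj_onI)
    have "(*) x ` ?U \<subseteq> ?U"
      using x K(4) by auto
    then have img: "(*) x ` ?U = ?U"
      using endo_inj_surj[of ?U] K(1) inj by auto
    have "prod id ?U = prod id ((*) x ` ?U)"
      using img by simp
    also have "\<dots> = (\<Prod>y\<in>?U. x * y)"
      using inj by (subst prod.reindex) auto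
    also have "\<dots> = x ^ card ?U * prod id ?U"
      by (simp add: prod.distrib)
    finally have "x ^ card ?U = 1"
      using K(1) by simp
    moreover have "card ?U = n - 1"
      using K by simp
    ultimately show ?thesis
      using assms(1) by (metis One_nat_def Suc_pred less_trans mult_1_right power_Suc zero_less_one)
  qed
  then have sub: "K \<subseteq> GF n"
    using assms(1) by (force simp: GF_def power_0_left)
  let ?p = "monom (1 :: 'a) n - [:0, 1:]"
  have "finite (GF n :: 'a set)" "card (GF n :: 'a set) \<le> n"
    using poly_X_pow_minus_X[OF assms(1), where 'a = 'a] poly_roots_finite[of ?p]
      card_poly_roots_bound[of ?p] by auto
  with sub K(2) show ?thesis
    by (metis card_seteq)
qed

lemma subfield_of_order_GF:
  assumes "n > 0"
  shows "subfield_of_order (2 ^ n) (GF (2 ^ n) :: F2bar set)"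
proof -
  let ?N = "2 ^ n :: nat"
  let ?p = "monom (1 :: F2bar) ?N - [:0, 1:]"
  have N: "?N > 1"
    using assms by (rule one_less_power[rotated]) simp
  note p = poly_X_pow_minus_X[OF N, where 'a = F2bar]
  have two: "(2 :: F2bar) = 0"
    using of_nat_CHAR[where 'a = F2bar] by simp
  have fd: "(x + y) ^ ?N = x ^ ?N + y ^ ?N" for x y :: F2bar
    by (rule freshmans_dream') simp_all
  have uminus: "- x = x" for x :: F2bar
    by (rule uminus_CHAR_2) (rule CHAR_F2bar)
  have "pderiv ?p = - 1"
    using assms two by (simp add: pderiv_diff pderiv_monom pderiv_pCons power_0_left one_pCons)
  then have der: "poly (pderiv ?p) x \<noteq> 0" for x
    by simp
  obtain A where A: "size A = degree ?p" "?p = smult (lead_coeff ?p) (\<Prod>x\<in>#A. [:-x, 1:])"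
    using alg_closed_imp_factorization[OF p(1)] by blast
  have "count A x \<le> 1" for x
  proof (rule ccontr)
    assume "\<not> count A x \<le> 1"
    then have "{#x, x#} \<subseteq># A"
      by (intro mset_subset_eqI) (auto simp: count_eq_zero_iff)
    then obtain B where "A = {#x, x#} + B"
      by (auto simp: mset_subset_eq_exists_conv)
    then have "?p = [:-x, 1:] * ([:-x, 1:] * smult (lead_coeff ?p) (\<Prod>y\<in>#B. [:-y, 1:]))"
      using A(2) by (simp add: mult.assoc)
    then obtain r where "?p = [:-x, 1:] * ([:-x, 1:] * r)"
      by blast
    then have "poly (pderiv ?p) x = 0"
      by (simp only: pderiv_mult poly_add poly_mult) simp
    with der show False by blast
  qed
  then have "A = mset_set (set_mset A)"
    by (intro multiset_eqI) (metis count_greater_eq_one_iff count_mset_set(1,3) finite_set_mset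
        le_antisym not_in_iff)
  then have "card (set_mset A) = ?N"
    using A(1) p(2) by (metis size_mset_set)
  moreover have "set_mset A = GF ?N"
  proof -
    have "poly (smult k (\<Prod>x\<in>#A. [:-x, 1:])) x = 0 \<longleftrightarrow> x \<in># A" if "k \<noteq> 0" for k x
      using that by (auto simp: poly_prod_mset prod_mset_zero_iff)
    moreover have "lead_coeff ?p \<noteq> 0"
      using p(1) by (simp only: leading_coeff_0_iff not_False_eq_True)
    ultimately have "poly ?p x = 0 \<longleftrightarrow> x \<in># A" for x
      using A(2) by metis
    then show ?thesis
      using p(3) by auto
  qed
  moreover have "finite (GF ?N :: F2bar set)"
    using calculation(2) by (metis finite_set_mset)
  ultimately show ?thesis
    by (auto simp: subfield_of_order_def GF_def fd uminus power_mult_distrib power_inverse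
        power_0_left)
qed

text \<open>The absolute trace from the field of order \<open>2^m\<close> to its prime field.\<close>
definition Tr :: "nat \<Rightarrow> 'a :: field \<Rightarrow> 'a" where
  "Tr m x = (\<Sum>i<m. x ^ (2 ^ i))"

definition is_cube_in :: "'a :: field set \<Rightarrow> 'a \<Rightarrow> bool" where
  "is_cube_in K x \<longleftrightarrow> (\<exists>y\<in>K. y ^ 3 = x)"

definition Gamma :: "nat \<Rightarrow> 'a :: field \<Rightarrow> nat \<Rightarrow> 'a set" where
  "Gamma q a l = {x \<in> GF (q ^ 3). x ^ (2 * q ^ l + 1) + x + a = 0}"

definition cpar :: "'a :: field \<Rightarrow> 'a \<Rightarrow> 'a" where
  "cpar \<omega> b = (b + \<omega>) / (b + \<omega>\<^sup>2)"

definition Lambda0 :: "nat \<Rightarrow> 'a :: field \<Rightarrow> 'a \<Rightarrow> 'a set" where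
  "Lambda0 q \<omega> b = {v + inverse v |v. v \<in> GF (q ^ 6) \<and> v ^ 3 = cpar \<omega> b}"

definition Lambda1 :: "nat \<Rightarrow> 'a :: field \<Rightarrow> 'a \<Rightarrow> 'a \<Rightarrow> 'a set" where
  "Lambda1 q a \<omega> b =
     {(inverse a + v + inverse v) / b\<^sup>2 |v. v \<in> GF (q ^ 6) \<and> v ^ 3 = \<omega> * cpar \<omega> b}"

definition Lambda2 :: "nat \<Rightarrow> 'a :: field \<Rightarrow> 'a \<Rightarrow> 'a \<Rightarrow> 'a set" where
  "Lambda2 q a \<omega> b =
     {(inverse a + v + inverse v) / (b\<^sup>2 + 1) |v. v \<in> GF (q ^ 6) \<and> v ^ 3 = \<omega>\<^sup>2 * cpar \<omega> b}"

text \<open>Meaningful for \<open>k \<in> {0, 1, 2}\<close> only.\<close>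
definition Lambda_idx :: "nat \<Rightarrow> 'a :: field \<Rightarrow> 'a \<Rightarrow> 'a \<Rightarrow> nat \<Rightarrow> 'a set" where
  "Lambda_idx q a \<omega> b k =
     (if k = 0 then Lambda0 q \<omega> b else if k = 1 then Lambda1 q a \<omega> b else Lambda2 q a \<omega> b)"

end

theory Submission
  imports Defs
begin

text \<open>
  Put \<open>\<phi>(x) = a / (x + 1)\<^sup>2\<close>. With \<open>\<sigma>\<close> the \<open>q\<^sup>\<ell>\<close>-power map, a root \<open>x\<close> of the trinomial satisfies
  \<open>x = \<phi>(\<sigma> x)\<close>, and if \<open>x\<close> lies in the field of order \<open>q\<^sup>3\<close>, then \<open>\<sigma>\<^sup>3\<close> fixes \<open>x\<close>, so \<open>x\<close> is a fixed
  point of \<open>\<phi>\<^sup>3\<close>. There are at most nine of those. They are the elements of the three sets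
  \<open>\<Lambda>\<^sub>k\<close>: in terms of the parameter \<open>v\<close> with \<open>v\<^sup>3 = \<omega>\<^sup>k c\<close>, the map \<open>\<phi>\<close> acts on \<open>\<Lambda>\<^sub>k\<close> as
  \<open>v \<mapsto> \<omega>\<^sup>2\<^sup>k v\<close>, whereas the \<open>q\<close>-power map acts as \<open>v \<mapsto> N\<^sub>k\<^sup>2 v\<close> with
  \<open>N\<^sub>k = (\<omega>\<^sup>k c)\<close> raised to the power \<open>(q\<^sup>2 - 1) / 3\<close>. Hence \<open>\<Lambda>\<^sub>k\<close> is contained in \<open>\<Gamma>\<close> if
  \<open>N\<^sub>k\<^sup>\<ell> = \<omega>\<^sup>2\<^sup>k\<close> and disjoint from it otherwise. Writing \<open>N\<^sub>0 = \<omega>\<^sup>n\<close>, one has \<open>N\<^sub>k = \<omega>\<^sup>k\<^sup>m\<^sup>+\<^sup>n\<close>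
  because \<open>(q\<^sup>2 - 1) / 3\<close> is congruent to \<open>m\<close> modulo 3, which leaves a finite case analysis in
  \<open>\<ell>\<close>, \<open>m\<close>, \<open>n\<close> modulo 3.
\<close>

section \<open>Characteristic 2: traces, Artin-Schreier equations, cubes and
  \<open>GF 4\<close>\<close>

lemma add_power_2_power:
  fixes x y :: "'a :: comm_ring_1"
  assumes "(2 :: 'a) = 0"
  shows "(x + y) ^ 2 ^ n = x ^ 2 ^ n + y ^ 2 ^ n"
proof (induction n)
  case (Suc n)
  have "(x + y) ^ 2 ^ Suc n = ((x + y) ^ 2 ^ n)\<^sup>2"
    by (simp add: power_mult mult.commute[of 2])
  also have "\<dots> = (x ^ 2 ^ n)\<^sup>2 + (y ^ 2 ^ n)\<^sup>2"
    using assms by (simp add: Suc power2_sum)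
  finally show ?case
    by (simp add: power_mult mult.commute[of 2])
qed simp

lemma Tr_add:
  assumes "(2 :: 'a :: field) = 0"
  shows "Tr m (x + y :: 'a) = Tr m x + Tr m y"
  by (simp add: Tr_def add_power_2_power[OF assms] sum.distrib)

text \<open>The sum telescopes: the conjugates of \<open>x\<^sup>2\<close> are those of
  \<open>x\<close> shifted by one place, and equal terms cancel in pairs.\<close>

lemma Tr_artin_schreier:
  assumes "(2 :: 'a :: field) = 0"
  shows "Tr m (x\<^sup>2 + x :: 'a) = x ^ 2 ^ m + x"
proof (induction m)
  case (Suc m)
  have "Tr (Suc m) (x\<^sup>2 + x) = x ^ 2 ^ m + x + ((x\<^sup>2) ^ 2 ^ m + x ^ 2 ^ m)"
    using Suc by (simp add: Tr_def add_power_2_power[OF assms])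
  also have "\<dots> = 2 * x ^ 2 ^ m + x ^ 2 ^ Suc m + x"
    by (simp add: power_mult)
  finally show ?case
    using assms by simp
qed (use assms in \<open>simp add: Tr_def\<close>)

lemma exists_power_eq:
  fixes x :: "'a :: alg_closed_field"
  assumes "n > 0"
  obtains y where "y ^ n = x"
  using nth_root_exists[OF assms] by metis

lemma exists_artin_schreier:
  fixes u :: "'a :: alg_closed_field"
  obtains x where "x\<^sup>2 + x = u"
proof -
  obtain x where "poly [:-u, 1, 1:] x = 0"
    using alg_closed_imp_poly_has_root[of "[:-u, 1, 1:]"] by auto
  then have "x\<^sup>2 + x = u"
    by (simp add: algebra_simps power2_eq_square)
  then show ?thesis ..
qed

text \<open>A cube root \<open>y\<close> of \<open>x\<close> in the algebraically closed field
  satisfies \<open>y ^ (r - 1) = x ^ ((r - 1) div 3)\<close>, so either all cube roots of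
  \<open>x\<close> lie in \<open>GF r\<close> or none does.\<close>

lemma is_cube_in_GF_iff:
  fixes x :: "'a :: alg_closed_field"
  assumes "x \<noteq> 0" "3 dvd r - 1" "r > 0"
  shows "is_cube_in (GF r) x \<longleftrightarrow> x ^ ((r - 1) div 3) = 1"
proof -
  have *: "x ^ ((r - 1) div 3) = 1 \<longleftrightarrow> y \<in> GF r" if "y ^ 3 = x" for y
  proof -
    have "y ^ r = y ^ (r - 1) * y"
      using assms(3) by (cases r) auto
    also have "y ^ (r - 1) = x ^ ((r - 1) div 3)"
      using assms(2) by (simp flip: that power_mult)
    finally show ?thesis
      using that assms(1) by (auto simp: GF_def)
  qed
  obtain y where "y ^ 3 = x"
    using exists_power_eq[of 3 x] by auto
  with * show ?thesis
    unfolding is_cube_in_def by blast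
qed

lemma GF4_minus_GF2_iff:
  assumes "(2 :: 'a :: field) = 0"
  shows "\<omega> \<in> GF 4 - GF 2 \<longleftrightarrow> \<omega>\<^sup>2 + \<omega> + 1 = (0 :: 'a)"
proof -
  have "\<omega>\<^sup>2 - \<omega> = \<omega> * (\<omega> - 1)"
    by (simp add: algebra_simps power2_eq_square)
  moreover have "\<omega> ^ 4 - \<omega> = \<omega> * (\<omega> - 1) * (\<omega>\<^sup>2 + \<omega> + 1)"
    by (simp add: algebra_simps power2_eq_square eval_nat_numeral)
  moreover have "\<omega> * (\<omega> - 1) \<noteq> 0" if "\<omega>\<^sup>2 + \<omega> + 1 = 0"
    using that assms by auto
  ultimately show ?thesis
    by (auto simp: GF_def simp flip: right_minus_eq[of _ \<omega>])
qed

text \<open>By \<open>Tr_artin_schreier\<close>, the trace of \<open>u\<close> is the obstruction to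
  a solution in the closure being fixed by the \<open>2 ^ m\<close>-power map.\<close>

lemma exists_artin_schreier_GF:
  fixes u :: "'a :: alg_closed_field"
  assumes "(2 :: 'a) = 0" "Tr m u = 0"
  obtains x where "x \<in> GF (2 ^ m)" "x\<^sup>2 + x = u"
proof -
  obtain x where x: "x\<^sup>2 + x = u"
    by (rule exists_artin_schreier)
  have "x ^ 2 ^ m + x = 0"
    using Tr_artin_schreier[OF assms(1), of m x] assms(2) x by simp
  moreover have "x + x = 0"
    using assms(1) by (metis mult_2 mult_zero_left)
  ultimately have "x ^ 2 ^ m = x"
    by (metis add_right_cancel)
  then show ?thesis
    using x by (intro that) (auto simp: GF_def)
qed

section \<open>Arithmetic of the parameters \<open>a\<close>, \<open>b\<close>,
  \<open>\<omega>\<close> and \<open>c\<close>\<close>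

locale char2_parameters =
  fixes a b \<omega> :: "'a :: alg_closed_field"
  assumes two: "(2 :: 'a) = 0"
    and a: "a \<noteq> 0" "a \<noteq> 1"
    and \<omega>: "\<omega>\<^sup>2 + \<omega> + 1 = 0"
    and b: "b\<^sup>2 + b = inverse a + 1"
begin

abbreviation c :: 'a where "c \<equiv> cpar \<omega> b"

lemma add_self: "x + x = (0 :: 'a)"
  using two by (metis mult_2 mult_zero_left)

lemma neg_eq: "- x = (x :: 'a)"
  using add_self by (metis minus_unique)

lemma eq_iff_add: "x = y \<longleftrightarrow> x + y = (0 :: 'a)"
  using neg_eq by (metis eq_neg_iff_add_eq_0)

lemma minus_eq_add: "x - y = x + (y :: 'a)"
  using neg_eq by (metis diff_conv_add_uminus)

lemma numeral_eq: "numeral (num.Bit0 n) = (0 :: 'a)" "numeral (num.Bit1 n) = (1 :: 'a)"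
  by (simp_all add: numeral.simps add_self)

lemma \<omega>_mult: "\<omega> * \<omega> = \<omega> + 1" "\<omega> * (\<omega> * x) = \<omega> * x + x"
proof -
  show "\<omega> * \<omega> = \<omega> + 1"
    using \<omega> eq_iff_add[of "\<omega> * \<omega>" "\<omega> + 1"] by (simp add: power2_eq_square add.assoc)
  then show "\<omega> * (\<omega> * x) = \<omega> * x + x"
    by (simp add: distrib_right flip: mult.assoc)
qed

lemma add_cancel: "x + (x + y) = (y :: 'a)"
  by (simp add: add_self flip: add.assoc)

text \<open>Rewriting with these rules decides polynomial identities over \<open>GF 4 = GF 2(\<omega>)\<close>.\<close>

lemmas F4_simps = algebra_simps power2_eq_square power3_eq_cube
  add_self add_cancel minus_eq_add neg_eq numeral_eq \<omega>_mult

lemma \<omega>_cubed: "\<omega> ^ 3 = 1"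
  by (simp add: F4_simps)

lemma \<omega>_nz: "\<omega> \<noteq> 0"
  using \<omega> by auto

lemma \<omega>_neq_1: "\<omega> \<noteq> 1"
  using \<omega> two by auto

lemma inverse_a: "inverse a = b\<^sup>2 + b + 1"
  using b by (simp add: F4_simps)

lemma a_mult: "a * (b\<^sup>2 + b + 1) = 1"
  using a by (simp flip: inverse_a)

text \<open>By \<open>inverse_a\<close>, numerator and denominator of \<open>c\<close> are thus
  complementary factors of 1/a, which makes both nonzero.\<close>

lemma norm_b_\<omega>: "(b + \<omega>) * (b + \<omega>\<^sup>2) = b\<^sup>2 + b + 1"
  by (simp add: F4_simps)

lemma b_neq: "b \<noteq> 0" "b \<noteq> 1" "b\<^sup>2 + 1 \<noteq> 0" "b + \<omega> \<noteq> 0" "b + \<omega>\<^sup>2 \<noteq> 0"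
proof -
  show nz: "b \<noteq> 0" "b \<noteq> 1"
    using a a_mult two by (auto simp: add_self)
  have "b\<^sup>2 + 1 = (b + 1)\<^sup>2"
    using two by (simp add: power2_sum)
  with nz show "b\<^sup>2 + 1 \<noteq> 0"
    using eq_iff_add[of b 1] by simp
  have "a * ((b + \<omega>) * (b + \<omega>\<^sup>2)) = 1"
    using a_mult norm_b_\<omega> by simp
  then show "b + \<omega> \<noteq> 0" "b + \<omega>\<^sup>2 \<noteq> 0"
    by auto
qed

lemma c_nz: "c \<noteq> 0"
  using b_neq by (simp add: cpar_def)

lemma c_mult: "c * (b + \<omega>\<^sup>2) = b + \<omega>"
  using b_neq by (simp add: cpar_def)

lemma cubes_nz: "v ^ 3 = \<omega> ^ k * c \<Longrightarrow> v \<noteq> 0"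
  using \<omega>_nz c_nz by auto

text \<open>This is what makes \<open>v + inverse v\<close> injective on the cube roots of
  \<open>\<omega> ^ k * c\<close>. The three cases would force
  \<open>\<omega>\<^sup>2 = \<omega>\<close>, \<open>b = 0\<close> and \<open>b = 1\<close>
  respectively.\<close>

lemma \<omega>_c_neq_1:
  assumes "k < 3"
  shows "\<omega> ^ k * c \<noteq> 1"
proof
  assume *: "\<omega> ^ k * c = 1"
  consider "k = 0" | "k = 1" | "k = 2"
    using assms by linarith
  then show False
  proof cases
    case 1
    with * c_mult have "b + \<omega>\<^sup>2 = b + \<omega>" by simp
    then show False by (simp add: F4_simps)
  next
    case 2
    have "\<omega> * (b + \<omega>) = (\<omega> ^ k * c) * (b + \<omega>\<^sup>2)"
      using 2 c_mult by (simp add: mult.assoc)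
    with * have "0 = \<omega> * (b + \<omega>) + (b + \<omega>\<^sup>2)" by (simp add: add_self)
    also have "\<dots> = (\<omega> + 1) * b" by (simp add: F4_simps)
    finally show False using b_neq(1) \<omega>_neq_1 unfolding eq_iff_add[of \<omega> 1] by simp
  next
    case 3
    have "\<omega>\<^sup>2 * (b + \<omega>) = (\<omega> ^ k * c) * (b + \<omega>\<^sup>2)"
      using 3 c_mult by (simp add: mult.assoc)
    with * have "0 = \<omega>\<^sup>2 * (b + \<omega>) + (b + \<omega>\<^sup>2)" by (simp add: add_self)
    also have "\<dots> = \<omega> * (b + 1)" by (simp add: F4_simps)
    finally show False using b_neq(2) \<omega>_nz unfolding eq_iff_add[of b 1] by simp
  qed
qed

section \<open>The points of the three sets and the action of \<phi> on them\<close>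

definition shift :: "nat \<Rightarrow> 'a" where
  "shift k = (if k = 0 then 0 else inverse a)"

definition scale :: "nat \<Rightarrow> 'a" where
  "scale k = (if k = 0 then 1 else if k = 1 then b\<^sup>2 else b\<^sup>2 + 1)"

text \<open>One parametrization for all three sets, so that \<phi> and the q-power map can be
  studied uniformly in \<open>k\<close>.\<close>

definition pt :: "nat \<Rightarrow> 'a \<Rightarrow> 'a" where
  "pt k v = (shift k + v + inverse v) / scale k"

definition pts :: "nat \<Rightarrow> 'a set" where
  "pts k = pt k ` {v. v ^ 3 = \<omega> ^ k * c}"

lemma scale_nz: "scale k \<noteq> 0"
  using b_neq by (simp add: scale_def)

text \<open>Equality of the sums gives (v - w)(vw - 1) = 0. If vw = 1, cubing gives
  \<open>(\<omega> ^ k * c)\<^sup>2 = 1\<close>, hence \<open>\<omega> ^ k * c = 1\<close> in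
  characteristic 2, contradicting \<open>\<omega>_c_neq_1\<close>.\<close>

lemma pt_eq_iff:
  assumes "k < 3" "v ^ 3 = \<omega> ^ k * c" "w ^ 3 = \<omega> ^ k * c"
  shows "pt k v = pt k w \<longleftrightarrow> v = w"
proof
  assume "pt k v = pt k w"
  then have "v + inverse v = w + inverse w"
    using scale_nz by (simp add: pt_def add.assoc)
  moreover have nz: "v \<noteq> 0" "w \<noteq> 0"
    using assms cubes_nz by auto
  ultimately have "(v - w) * (v * w - 1) = 0"
    by (simp add: field_simps)
  moreover have False if "v * w = 1"
  proof -
    have "(\<omega> ^ k * c)\<^sup>2 = v ^ 3 * w ^ 3"
      by (simp add: assms power2_eq_square)
    also have "\<dots> = 1"
      using that by (simp flip: power_mult_distrib)
    finally have "(\<omega> ^ k * c + 1)\<^sup>2 = 0"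
      using two by (simp add: power2_sum)
    with \<omega>_c_neq_1[OF assms(1)] show False
      using eq_iff_add[of "\<omega> ^ k * c" 1] by simp
  qed
  ultimately show "v = w" by auto
qed simp

text \<open>In characteristic 2, s(s + 1)^2 = s^3 + s is the Dickson polynomial sending v + 1/v to
  v^3 + 1/v^3. Here the latter is c + 1/c = a, because
  \<open>(b + \<omega>)\<^sup>2 + (b + \<omega>\<^sup>2)\<^sup>2 = 1\<close> and the product of the
  two bases is 1/a.\<close>

lemma pt_step_0:
  assumes "v ^ 3 = c"
  shows "(v + inverse v) * (v + inverse v + 1)\<^sup>2 = a"
proof -
  have nz: "v \<noteq> 0" using cubes_nz[of v 0] assms by simp
  define u where "u = inverse v"
  have uv: "u * v = 1" using nz by (simp add: u_def)
  have "u ^ 3 * c = 1" using uv by (simp flip: assms power_mult_distrib)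
  with c_mult have u3: "u ^ 3 * (b + \<omega>) = b + \<omega>\<^sup>2" by Groebner_Basis.algebra
  have v3: "v ^ 3 * (b + \<omega>\<^sup>2) = b + \<omega>" using c_mult assms by simp
  have "(v ^ 3 + u ^ 3) * ((b + \<omega>) * (b + \<omega>\<^sup>2))
      = v ^ 3 * (b + \<omega>\<^sup>2) * (b + \<omega>) + u ^ 3 * (b + \<omega>) * (b + \<omega>\<^sup>2)"
    by (simp add: algebra_simps)
  also have "\<dots> = 1"
    unfolding u3 v3 by (simp add: F4_simps)
  also have "\<dots> = a * ((b + \<omega>) * (b + \<omega>\<^sup>2))"
    using a_mult norm_b_\<omega> by simp
  finally have sum: "v ^ 3 + u ^ 3 = a" using b_neq by simp
  have "(v + u) * (v + u + 1)\<^sup>2 = (v + u) * (v\<^sup>2 + u\<^sup>2 + 1)"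
    by (simp add: F4_simps)
  also have "\<dots> = v ^ 3 + u ^ 3 + (v * u) * (v + u) + (v + u)"
    by (simp add: algebra_simps power2_eq_square power3_eq_cube)
  also have "\<dots> = a"
    using uv sum by (simp add: mult.commute add_self add.assoc)
  finally show ?thesis by (simp add: u_def)
qed

text \<open>After clearing the denominators \<open>b\<^sup>2\<close>, the claim is a polynomial
  identity in \<open>v\<close> and \<open>u = inverse v\<close>. The relations \<open>h1\<close> to
  \<open>h4\<close> reduce its terms until those linear in \<open>v\<close> and \<open>u\<close>
  cancel.\<close>

lemma pt_step_1:
  assumes "v ^ 3 = \<omega> * c"
  shows "(inverse a + \<omega>\<^sup>2 * v + inverse (\<omega>\<^sup>2 * v)) / b\<^sup>2 * ((inverse a + v + inverse v) / b\<^sup>2 + 1)\<^sup>2 = a"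
proof -
  have nz: "v \<noteq> 0" using cubes_nz[of v 1] assms by simp
  define u where "u = inverse v"
  have uv: "u * v = 1" using nz by (simp add: u_def)
  have inv: "inverse (\<omega>\<^sup>2 * v) = \<omega> * u"
    using \<omega>_cubed nz by (intro inverse_unique) (simp add: u_def power2_eq_square power3_eq_cube mult_ac)
  have v3: "v ^ 3 * (b + \<omega>\<^sup>2) = \<omega> * (b + \<omega>)" using c_mult assms by simp
  have "u ^ 3 * (\<omega> * c) = 1" using uv by (simp flip: assms power_mult_distrib)
  with c_mult \<omega>_cubed have u3: "u ^ 3 * (b + \<omega>) = \<omega>\<^sup>2 * (b + \<omega>\<^sup>2)" by Groebner_Basis.algebra
  have "(\<omega>\<^sup>2 * v ^ 3 + \<omega> * u ^ 3) * ((b + \<omega>) * (b + \<omega>\<^sup>2))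
      = \<omega>\<^sup>2 * (v ^ 3 * (b + \<omega>\<^sup>2)) * (b + \<omega>) + \<omega> * (u ^ 3 * (b + \<omega>)) * (b + \<omega>\<^sup>2)"
    by (simp add: algebra_simps)
  also have "\<dots> = 1"
    unfolding u3 v3 by (simp add: F4_simps)
  also have "\<dots> = a * ((b + \<omega>) * (b + \<omega>\<^sup>2))"
    using a_mult norm_b_\<omega> by simp
  finally have h3: "\<omega>\<^sup>2 * v ^ 3 + \<omega> * u ^ 3 = a" using b_neq by simp
  define A where "A = b\<^sup>2 + b + 1"
  \<comment> \<open>Since uv = 1, the square of \<open>u\<close> is \<open>u ^ 3 * v\<close>, so the
    relation for the cube lowers a quadratic term to a linear one.\<close>
  have "A * u\<^sup>2 = (b + \<omega>\<^sup>2) * (u ^ 3 * (b + \<omega>)) * v"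
    using uv unfolding A_def norm_b_\<omega>[symmetric] by Groebner_Basis.algebra
  also have "\<dots> = \<omega>\<^sup>2 * (b\<^sup>2 + \<omega>) * v"
    unfolding u3 by (simp add: F4_simps)
  finally have h1: "A * u\<^sup>2 = \<omega>\<^sup>2 * (b\<^sup>2 + \<omega>) * v" .
  have "A * v\<^sup>2 = (b + \<omega>) * (v ^ 3 * (b + \<omega>\<^sup>2)) * u"
    using uv unfolding A_def norm_b_\<omega>[symmetric] by Groebner_Basis.algebra
  also have "\<dots> = (\<omega> * b\<^sup>2 + 1) * u"
    unfolding v3 by (simp add: F4_simps)
  finally have h2: "A * v\<^sup>2 = (\<omega> * b\<^sup>2 + 1) * u" .
  \<comment> \<open>Here aA = 1, and A^2 (b + 1)^2 = (b^3 + 1)^2 = b^6 + 1.\<close>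
  have "A * (b\<^sup>2 + 1) = a * A * (A * (b\<^sup>2 + 1))"
    using a_mult by (simp add: A_def)
  also have "\<dots> = a * b ^ 6 + a"
    unfolding A_def by (simp add: F4_simps eval_nat_numeral)
  finally have h4: "A * (b\<^sup>2 + 1) = a * b ^ 6 + a" .
  have "(A + \<omega>\<^sup>2 * v + \<omega> * u) * (b\<^sup>2 + 1 + v\<^sup>2 + u\<^sup>2)
      = A * (b\<^sup>2 + 1) + A * u\<^sup>2 + A * v\<^sup>2 + (\<omega>\<^sup>2 * v ^ 3 + \<omega> * u ^ 3)
        + (b\<^sup>2 + 1) * (\<omega>\<^sup>2 * v + \<omega> * u) + (\<omega>\<^sup>2 * u + \<omega> * v) * (u * v)"
    by (simp add: algebra_simps power2_eq_square power3_eq_cube)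
  also have "\<dots> = a * b ^ 6"
    unfolding h1 h2 h3 h4 uv by (simp add: F4_simps)
  finally have *: "(A + \<omega>\<^sup>2 * v + \<omega> * u) * (b\<^sup>2 + 1 + v\<^sup>2 + u\<^sup>2) = a * b ^ 6" .
  have "(A + v + u + b\<^sup>2)\<^sup>2 = b\<^sup>2 + 1 + v\<^sup>2 + u\<^sup>2"
    unfolding A_def by (simp add: F4_simps)
  with * have *: "(A + \<omega>\<^sup>2 * v + \<omega> * u) * (A + v + u + b\<^sup>2)\<^sup>2 = a * b ^ 6"
    by simp
  have "(A + v + u) / b\<^sup>2 + 1 = (A + v + u + b\<^sup>2) / b\<^sup>2"
    using b_neq by (simp add: add_divide_distrib)
  then show ?thesis
    using * b_neq unfolding inv u_def[symmetric] inverse_a A_def[symmetric]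
    by (simp add: power_divide flip: power_mult power_add)
qed

text \<open>Replacing \<open>b\<close> by \<open>b + 1\<close> and \<open>\<omega>\<close> by its conjugate fixes \<open>c\<close> and exchanges \<open>\<Lambda>\<^sub>1\<close> and \<open>\<Lambda>\<^sub>2\<close>, so
  that the case \<open>k = 2\<close> of \<open>pt_step\<close> follows from \<open>k = 1\<close>.\<close>

lemma conjugate: "char2_parameters a (b + 1) (\<omega>\<^sup>2)" and cpar_conjugate: "cpar (\<omega>\<^sup>2) (b + 1) = c"
proof -
  have "(\<omega>\<^sup>2)\<^sup>2 + \<omega>\<^sup>2 + 1 = 0" "(b + 1)\<^sup>2 + (b + 1) = inverse a + 1"
    using b by (simp_all add: F4_simps)
  then show "char2_parameters a (b + 1) (\<omega>\<^sup>2)"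
    using two a by unfold_locales
  have "b + 1 + \<omega>\<^sup>2 = b + \<omega>" "b + 1 + (\<omega>\<^sup>2)\<^sup>2 = b + \<omega>\<^sup>2"
    by (simp_all add: F4_simps)
  then show "cpar (\<omega>\<^sup>2) (b + 1) = c"
    by (simp only: cpar_def)
qed

text \<open>The formula for \<phi> on the three sets, stated as a product. As \<open>a\<close> is
  nonzero, it also shows that \<open>pt k v + 1\<close> is nonzero, so it determines the image under
  \<phi>.\<close>

lemma pt_step:
  assumes "k < 3" "v ^ 3 = \<omega> ^ k * c"
  shows "pt k (\<omega> ^ (2 * k) * v) * (pt k v + 1)\<^sup>2 = a"
proof -
  consider "k = 0" | "k = 1" | "k = 2"
    using assms by linarith
  then show ?thesis
  proof cases
    case 1
    then show ?thesis using pt_step_0 assms by (simp add: pt_def shift_def scale_def)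
  next
    case 2
    then show ?thesis using pt_step_1 assms by (simp add: pt_def shift_def scale_def)
  next
    case 3
    interpret conj: char2_parameters a "b + 1" "\<omega>\<^sup>2" by (rule conjugate)
    have "(b + 1)\<^sup>2 = b\<^sup>2 + 1" using two by (simp add: power2_sum)
    then show ?thesis
      using conj.pt_step_1[of v] assms 3 by (simp add: pt_def shift_def scale_def cpar_conjugate flip: power_mult)
  qed
qed

lemma pt_inverse: "pt k (inverse v) = pt k v"
  by (simp add: pt_def algebra_simps)

section \<open>Counting and separating the three sets; the points fixed by the third iterate of
  \<phi>\<close>

lemma \<omega>_power_eq_iff: "\<omega> ^ i = \<omega> ^ j \<longleftrightarrow> i mod 3 = j mod 3"
proof -
  have mod: "\<omega> ^ i = \<omega> ^ (i mod 3)" for i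
  proof -
    have "\<omega> ^ i = \<omega> ^ (3 * (i div 3) + i mod 3)"
      by simp
    then show ?thesis
      by (simp only: power_add power_mult \<omega>_cubed power_one mult_1_left)
  qed
  have ne: "\<omega>\<^sup>2 \<noteq> 1" "\<omega>\<^sup>2 \<noteq> \<omega>"
    using \<omega>_nz by (simp_all add: \<omega>_mult power2_eq_square)
  have "inj_on ((^) \<omega>) {0, 1, 2}"
    using ne \<omega>_neq_1 ne[symmetric] \<omega>_neq_1[symmetric] by (simp add: inj_on_def)
  moreover have "i mod 3 \<in> {0, 1, 2}" for i :: nat
    by (simp, presburger)
  ultimately show ?thesis
    by (metis mod inj_on_eq_iff)
qed

lemma cube_root_of_unity:
  assumes "x ^ 3 = 1"
  obtains n where "n < 3" "x = \<omega> ^ n"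
proof -
  have "(x + 1) * ((x + \<omega>) * (x + \<omega>\<^sup>2)) = x ^ 3 + 1"
    by (simp add: F4_simps)
  also have "\<dots> = 0"
    using assms two by simp
  finally have "x + 1 = 0 \<or> x + \<omega> = 0 \<or> x + \<omega>\<^sup>2 = 0"
    by (simp only: mult_eq_0_iff)
  then have "x = \<omega> ^ 0 \<or> x = \<omega> ^ 1 \<or> x = \<omega> ^ 2"
    unfolding eq_iff_add[symmetric] by (simp only: power_0 power_one_right)
  then show ?thesis
    using that[of 0] that[of 1] that[of 2] by auto
qed

lemma card_cube_roots:
  fixes x :: 'a
  assumes "x \<noteq> 0"
  shows "card {v. v ^ 3 = x} = 3"
proof -
  obtain v where v: "v ^ 3 = x"
    using exists_power_eq[of 3 x] by auto
  then have nz: "v \<noteq> 0" using assms by auto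
  have "{v. v ^ 3 = x} = (\<lambda>n. \<omega> ^ n * v) ` {..<3}"
  proof (intro equalityI subsetI)
    fix w assume "w \<in> {v. v ^ 3 = x}"
    then have "(w / v) ^ 3 = 1"
      using v assms by (simp add: power_divide)
    then obtain n where "n < 3" "w / v = \<omega> ^ n"
      by (rule cube_root_of_unity)
    then show "w \<in> (\<lambda>n. \<omega> ^ n * v) ` {..<3}"
      using nz by (auto simp: field_simps)
  next
    fix w assume "w \<in> (\<lambda>n. \<omega> ^ n * v) ` {..<3}"
    then show "w \<in> {v. v ^ 3 = x}"
      using v \<omega>_cubed by (auto simp: power_mult_distrib simp flip: power_mult) (simp add: power_mult mult.commute[of _ 3])
  qed
  moreover have "inj_on (\<lambda>n. \<omega> ^ n * v) {..<3}"
    using nz by (auto simp: inj_on_def \<omega>_power_eq_iff)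
  ultimately show ?thesis
    by (simp add: card_image)
qed

lemma card_pts: "k < 3 \<Longrightarrow> card (pts k) = 3"
  unfolding pts_def using card_cube_roots[of "\<omega> ^ k * c"] \<omega>_nz c_nz
  by (subst card_image) (auto intro!: inj_onI simp: pt_eq_iff)

lemma \<omega>_power_mult_cubed: "(\<omega> ^ n * v) ^ 3 = v ^ 3"
  using power_mult[of \<omega> 3 n] power_mult[of \<omega> n 3]
  by (simp add: power_mult_distrib \<omega>_cubed mult.commute)

lemma pt_orbit:
  assumes "k < 3" "v ^ 3 = \<omega> ^ k * c"
  defines "\<delta> \<equiv> \<omega> ^ (2 * k)"
  shows "pt k (\<delta> * v) * (pt k v + 1)\<^sup>2 = a"
    and "pt k (\<delta>\<^sup>2 * v) * (pt k (\<delta> * v) + 1)\<^sup>2 = a"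
    and "pt k v * (pt k (\<delta>\<^sup>2 * v) + 1)\<^sup>2 = a"
proof -
  note step = pt_step[OF assms(1), folded \<delta>_def]
  have \<delta>3: "\<delta> * \<delta>\<^sup>2 = 1"
    using \<omega>_power_mult_cubed[of "2 * k" 1]
    by (simp add: \<delta>_def power3_eq_cube power2_eq_square mult.assoc)
  have cubes: "(\<delta> * v) ^ 3 = \<omega> ^ k * c" "(\<delta>\<^sup>2 * v) ^ 3 = \<omega> ^ k * c"
    unfolding \<delta>_def power_mult[symmetric] \<omega>_power_mult_cubed by (fact assms(2))+
  show "pt k (\<delta> * v) * (pt k v + 1)\<^sup>2 = a"
    using step assms(2) .
  show "pt k (\<delta>\<^sup>2 * v) * (pt k (\<delta> * v) + 1)\<^sup>2 = a"
    using step[OF cubes(1)] by (simp add: power2_eq_square mult.assoc)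
  show "pt k v * (pt k (\<delta>\<^sup>2 * v) + 1)\<^sup>2 = a"
    using step[OF cubes(2)] \<delta>3 by (simp flip: mult.assoc)
qed

text \<open>For these \<open>k\<close> the multiplier \<open>\<omega> ^ (2 * k)\<close> differs from
  1, so \<phi> moves every point. By contrast, \<phi> fixes all of \<open>pts 0\<close>.\<close>

lemma pt_neq_fixed:
  assumes "k \<in> {1, 2}" "v ^ 3 = \<omega> ^ k * c"
  shows "pt k v * (pt k v + 1)\<^sup>2 \<noteq> a"
proof
  assume "pt k v * (pt k v + 1)\<^sup>2 = a"
  moreover have k: "k < 3"
    using assms by auto
  moreover note pt_orbit(1)[OF k assms(2)]
  ultimately have "pt k (\<omega> ^ (2 * k) * v) = pt k v"
    using a by (metis mult_right_cancel mult_zero_right)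
  then have "\<omega> ^ (2 * k) * v = v"
    using pt_eq_iff k assms(2) \<omega>_power_mult_cubed by metis
  then have "\<omega> ^ (2 * k) = \<omega> ^ 0"
    using cubes_nz[OF assms(2)] by simp
  then show False
    using assms(1) unfolding \<omega>_power_eq_iff by auto
qed

text \<open>The three multiples of \<open>v\<close> sum to 0, and so do their inverses; of the
  shifts, 3/a = 1/a remains. The result is an invariant of the \<phi>-orbit that tells
  \<open>pts 1\<close> from \<open>pts 2\<close>.\<close>

lemma pt_orbit_sum:
  assumes "k \<in> {1, 2}" "v ^ 3 = \<omega> ^ k * c"
  defines "\<delta> \<equiv> \<omega> ^ (2 * k)"
  shows "pt k v + pt k (\<delta> * v) + pt k (\<delta>\<^sup>2 * v) = inverse a / scale k"
proof -
  have \<delta>: "\<delta>\<^sup>2 + \<delta> + 1 = 0"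
    using assms(1) unfolding \<delta>_def by (auto simp: eval_nat_numeral F4_simps)
  have "inverse \<delta> = \<delta>\<^sup>2"
    using \<omega>_power_mult_cubed[of "2 * k" 1]
    by (intro inverse_unique) (simp add: \<delta>_def power3_eq_cube power2_eq_square mult.assoc)
  moreover have "inverse (\<delta>\<^sup>2) = \<delta>"
    using calculation by (metis inverse_inverse_eq)
  moreover have "shift k = inverse a"
    using assms(1) by (auto simp: shift_def)
  ultimately have "pt k v + pt k (\<delta> * v) + pt k (\<delta>\<^sup>2 * v)
      = (inverse a + inverse a + inverse a + (\<delta>\<^sup>2 + \<delta> + 1) * (v + inverse v)) / scale k"
    unfolding pt_def by (simp add: algebra_simps flip: add_divide_distrib)
  then show ?thesis
    using \<delta> by (simp add: add_self)
qed

lemma pts_disjoint: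
  assumes "i < 3" "j < 3" "i \<noteq> j"
  shows "pts i \<inter> pts j = {}"
proof -
  have 0: "pts 0 \<inter> pts k = {}" if "k \<in> {1, 2}" for k
  proof -
    have "x * (x + 1)\<^sup>2 = a" if "x \<in> pts 0" for x
      using that pt_step[of 0] unfolding pts_def by auto
    moreover have "x * (x + 1)\<^sup>2 \<noteq> a" if "x \<in> pts k" for x
      using that pt_neq_fixed[OF \<open>k \<in> {1, 2}\<close>] unfolding pts_def by auto
    ultimately show ?thesis
      by (metis disjoint_iff)
  qed
  have 12: "pts 1 \<inter> pts 2 = {}"
  proof (rule ccontr)
    let ?\<delta> = "\<lambda>k. \<omega> ^ (2 * k)"
    assume "pts 1 \<inter> pts 2 \<noteq> {}"
    then obtain v w where *: "v ^ 3 = \<omega> ^ 1 * c" "w ^ 3 = \<omega> ^ 2 * c" "pt 1 v = pt 2 w"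
      unfolding pts_def by blast
    have "(1 :: nat) < 3" "(2 :: nat) < 3"
      by simp_all
    note v = pt_orbit[OF this(1) *(1)] and w = pt_orbit[OF this(2) *(2)]
    \<comment> \<open>Single-valuedness of \<phi>: a common point forces the two orbits to agree
      term by term, hence to have equal sums.\<close>
    have step: "y = z" if "y * (x + 1)\<^sup>2 = a" "z * (x + 1)\<^sup>2 = a" for x y z :: 'a
      using that a by (metis mult_right_cancel mult_zero_right)
    have 1: "pt 1 (?\<delta> 1 * v) = pt 2 (?\<delta> 2 * w)"
      by (rule step[OF v(1) w(1)[folded *(3)]])
    have 2: "pt 1 ((?\<delta> 1)\<^sup>2 * v) = pt 2 ((?\<delta> 2)\<^sup>2 * w)"
      by (rule step[OF v(2) w(2)[folded 1]])
    then have "inverse a / scale 1 = inverse a / scale 2"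
      using *(3) 1 2 pt_orbit_sum[OF _ *(1)] pt_orbit_sum[OF _ *(2)] by (metis insertCI)
    then have "scale 1 = scale 2"
      using a scale_nz by (simp add: field_simps)
    then show False
      by (simp add: scale_def)
  qed
  from assms have "i = 0 \<and> j \<in> {1, 2} \<or> j = 0 \<and> i \<in> {1, 2} \<or> i = 1 \<and> j = 2 \<or> i = 2 \<and> j = 1"
    by auto
  then show ?thesis
    using 0 12 by (metis Int_commute)
qed

text \<open>Eliminating \<open>y\<close> and \<open>z\<close> leaves a polynomial \<open>R\<close>
  in \<open>x\<close> of degree 9. Its leading coefficient (a + 1)^2 is nonzero because
  \<open>a\<close> is not 1. The nine points of the three disjoint sets are roots of
  \<open>R\<close>, so they are all of its roots.\<close>

lemma three_cycle_iff_pts: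
  "(\<exists>y z. x * (y + 1)\<^sup>2 = a \<and> y * (z + 1)\<^sup>2 = a \<and> z * (x + 1)\<^sup>2 = a)
    \<longleftrightarrow> x \<in> pts 0 \<union> pts 1 \<union> pts 2" (is "?cyclic x \<longleftrightarrow> _ \<in> ?U")
proof -
  define R where "R = [:a * (1 + a ^ 4), a\<^sup>2 + 1 + a ^ 4, 0, 0, 0, 0, 0, 0, a, a\<^sup>2 + 1:]"
  have R: "poly R x = 0" if "?cyclic x" for x
  proof -
    from that obtain y z where
      *: "x * (y + 1)\<^sup>2 = a" "y * (z + 1)\<^sup>2 = a" "z * (x + 1)\<^sup>2 = a"
      by blast
    \<comment> \<open>Squaring the third equation removes \<open>z\<close> and expresses
      \<open>y\<close> as a rational function of \<open>x\<close>, written without division.\<close>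
    have "y * (a\<^sup>2 + x ^ 4 + 1) = y * ((z * (x + 1)\<^sup>2)\<^sup>2 + (x + 1) ^ 4)"
      unfolding *(3) by (simp add: F4_simps eval_nat_numeral)
    also have "\<dots> = y * (z + 1)\<^sup>2 * (x + 1) ^ 4"
      by (simp add: F4_simps eval_nat_numeral)
    also have "\<dots> = a * (x ^ 4 + 1)"
      unfolding *(2) by (simp add: F4_simps eval_nat_numeral)
    finally have y: "y * (a\<^sup>2 + x ^ 4 + 1) = a * (x ^ 4 + 1)" .
    have "a * (a\<^sup>2 + x ^ 4 + 1)\<^sup>2 = x * (y + 1)\<^sup>2 * (a\<^sup>2 + x ^ 4 + 1)\<^sup>2"
      unfolding *(1) ..
    also have "\<dots> = x * (y * (a\<^sup>2 + x ^ 4 + 1) + (a\<^sup>2 + x ^ 4 + 1))\<^sup>2"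
      by (simp add: power_mult_distrib algebra_simps flip: power_mult_distrib)
    also have "\<dots> = x * (a * (x ^ 4 + 1) + (a\<^sup>2 + x ^ 4 + 1))\<^sup>2"
      unfolding y ..
    finally have "0 = a * (a\<^sup>2 + x ^ 4 + 1)\<^sup>2 + x * (a * (x ^ 4 + 1) + (a\<^sup>2 + x ^ 4 + 1))\<^sup>2"
      by (simp add: add_self)
    also have "\<dots> = poly R x"
      unfolding R_def by (simp add: F4_simps eval_nat_numeral)
    finally show ?thesis ..
  qed
  have pts: "?cyclic x" if "x \<in> ?U" for x
  proof -
    have "(0 :: nat) < 3" "(1 :: nat) < 3" "(2 :: nat) < 3"
      by simp_all
    with that obtain k where k: "k < 3" "x \<in> pts k"
      by blast
    then obtain v where "v ^ 3 = \<omega> ^ k * c" "x = pt k v"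
      by (auto simp: pts_def)
    with pt_orbit[OF k(1)] show ?thesis by metis
  qed
  have "a\<^sup>2 + 1 = (a + 1)\<^sup>2"
    using two by (simp add: power2_sum)
  then have "a\<^sup>2 + 1 \<noteq> 0"
    using a(2) eq_iff_add[of a 1] by simp
  then have deg: "degree R = 9" "R \<noteq> 0"
    by (simp_all add: R_def)
  have fin: "finite (pts k)" if "k < 3" for k
    using card_pts[OF that] by (metis card.infinite zero_neq_numeral)
  have "card ?U = card (pts 0 \<union> pts 1) + card (pts 2)"
    using fin pts_disjoint[of 0 2] pts_disjoint[of 1 2] by (intro card_Un_disjoint) auto
  also have "card (pts 0 \<union> pts 1) = card (pts 0) + card (pts 1)"
    using fin pts_disjoint[of 0 1] by (intro card_Un_disjoint) auto
  finally have "card ?U = 9"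
    by (simp add: card_pts)
  moreover have "card {x. poly R x = 0} \<le> 9"
    using card_poly_roots_bound[OF deg(2)] deg(1) by simp
  moreover have "?U \<subseteq> {x. poly R x = 0}"
    using pts R by blast
  moreover have "finite {x. poly R x = 0}"
    using poly_roots_finite deg(2) by blast
  ultimately have "?U = {x. poly R x = 0}"
    by (metis card_seteq)
  then show ?thesis
    using pts R by blast
qed

end

section \<open>The action of the q-power map on the points\<close>

locale char2_frobenius = char2_parameters +
  fixes m q :: nat
  assumes q: "q = 2 ^ m" and b_pow_q: "b ^ q = b"
begin

lemma q_pos: "q > 0"
  by (simp add: q)

lemma add_pow_q: "(x + y) ^ q = x ^ q + y ^ q" for x y :: 'a
  unfolding q by (rule add_power_2_power[OF two])

text \<open>This is (1 + 3)^m = 1 + 3m modulo 9; it yields the residue of (q^2 - 1)/3 modulo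
  3.\<close>

lemma q_square_expand: obtains t where "q\<^sup>2 = 1 + 3 * (m + 3 * t)"
proof -
  have "\<exists>t. 4 ^ m = 1 + 3 * (m + 3 * t)"
  proof (induction m)
    case (Suc m)
    then obtain t where "4 ^ m = 1 + 3 * (m + 3 * t)" ..
    then have "4 ^ Suc m = 1 + 3 * (Suc m + 3 * (m + 4 * t))"
      by simp
    then show ?case ..
  qed simp
  moreover have "q\<^sup>2 = 4 ^ m"
    by (simp add: q power2_eq_square flip: power_mult_distrib)
  ultimately show ?thesis
    using that by metis
qed

definition e :: nat where
  "e = (q\<^sup>2 - 1) div 3"

lemma e_mod: "e mod 3 = m mod 3" and q_square_e: "q\<^sup>2 = 3 * e + 1"
proof -
  obtain t where t: "q\<^sup>2 = 1 + 3 * (m + 3 * t)"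
    by (rule q_square_expand)
  then have "e = m + 3 * t"
    by (simp add: e_def)
  then show "e mod 3 = m mod 3" "q\<^sup>2 = 3 * e + 1"
    using t by simp_all
qed

lemma pow_q_of_cube_root_of_unity:
  assumes "x ^ 3 = (1 :: 'a)"
  shows "x ^ q = (if even m then x else x\<^sup>2)"
  unfolding q
proof (induction m)
  case (Suc m)
  have "x ^ 2 ^ Suc m = (x ^ 2 ^ m)\<^sup>2"
    by (simp add: power_mult mult.commute[of 2])
  moreover have "(x\<^sup>2)\<^sup>2 = x"
    using assms by (simp add: power2_eq_square power3_eq_cube mult.assoc)
  ultimately show ?case
    using Suc by simp
qed simp

text \<open>The cubic residue character of \<open>\<omega> ^ k * c\<close> in the field of order
  q^2.\<close>

definition N :: "nat \<Rightarrow> 'a" where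
  "N k = (\<omega> ^ k * c) ^ e"

text \<open>The q-power map fixes \<open>b\<close>. For odd \<open>m\<close> it interchanges
  \<open>\<omega>\<close> and \<open>\<omega>\<^sup>2\<close>, hence the numerator and denominator
  of \<open>c\<close>; for even \<open>m\<close> it fixes \<open>\<omega>\<close> too.\<close>

lemma pow_q_cubes: "(\<omega> ^ k * c) ^ q = (if even m then \<omega> ^ k * c else inverse (\<omega> ^ k * c))"
proof -
  have \<omega>q: "\<omega> ^ q = (if even m then \<omega> else \<omega>\<^sup>2)"
    by (rule pow_q_of_cube_root_of_unity[OF \<omega>_cubed])
  have \<omega>4: "(\<omega>\<^sup>2)\<^sup>2 = \<omega>"
    by (simp add: F4_simps)
  have "(\<omega> ^ j) ^ q = (\<omega> ^ q) ^ j" for j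
    by (simp add: mult.commute flip: power_mult)
  then have "(\<omega> ^ k * c) ^ q = (\<omega> ^ q) ^ k * ((b + \<omega> ^ q) / (b + (\<omega> ^ q)\<^sup>2))"
    by (simp only: cpar_def power_mult_distrib power_divide add_pow_q b_pow_q)
  moreover have "inverse \<omega> = \<omega>\<^sup>2"
    using \<omega>_cubed by (intro inverse_unique) (simp add: power2_eq_square power3_eq_cube mult.assoc)
  then have "(\<omega>\<^sup>2) ^ k = inverse (\<omega> ^ k)"
    by (metis power_inverse)
  ultimately show ?thesis
    unfolding \<omega>q by (cases "even m") (simp_all only: if_True if_False \<omega>4 cpar_def
        inverse_mult_distrib inverse_divide)
qed

lemma N_cubed: "N k ^ 3 = 1"
proof -
  define g where "g = \<omega> ^ k * c"
  have "g ^ q = (if even m then g else inverse g)"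
    unfolding g_def by (rule pow_q_cubes)
  then have "(g ^ q) ^ q = g"
    by (simp add: power_inverse)
  then have "(\<omega> ^ k * c) ^ q\<^sup>2 = \<omega> ^ k * c"
    by (simp only: power2_eq_square power_mult g_def)
  then have "N k ^ 3 * (\<omega> ^ k * c) = \<omega> ^ k * c"
    by (simp add: N_def q_square_e mult.commute flip: power_mult)
  then show ?thesis
    using \<omega>_nz c_nz by simp
qed

lemma pow_q_square:
  assumes "v ^ 3 = \<omega> ^ k * c"
  shows "v ^ q\<^sup>2 = N k * v"
  by (simp add: q_square_e N_def power_mult flip: assms)

lemma shift_pow_q: "shift k ^ q = shift k" and scale_pow_q: "scale k ^ q = scale k"
proof -
  have "(x\<^sup>2) ^ q = (x ^ q)\<^sup>2" for x :: 'a
    by (simp add: mult.commute flip: power_mult)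
  then show "shift k ^ q = shift k" "scale k ^ q = scale k"
    using q_pos by (simp_all add: shift_def scale_def inverse_a add_pow_q b_pow_q power_0_left)
qed

text \<open>The q-power of \<open>v\<close> is \<open>\<epsilon> * v\<close> for even
  \<open>m\<close> and \<open>\<epsilon> * inverse v\<close> for odd \<open>m\<close>, with
  \<open>\<epsilon> ^ 3 = 1\<close>. Comparing its second iterate with \<open>pow_q_square\<close>
  gives \<open>N k = \<epsilon>\<^sup>2\<close> or \<open>N k = \<epsilon>\<close>. Invariance of
  \<open>pt k\<close> under inversion merges the two cases.\<close>

lemma pt_pow_q:
  assumes v: "v ^ 3 = \<omega> ^ k * c"
  shows "pt k v ^ q = pt k ((N k)\<^sup>2 * v)"
proof -
  have nz: "v \<noteq> 0"
    using cubes_nz[OF v] .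
  have vq: "(v ^ q) ^ 3 = (\<omega> ^ k * c) ^ q"
    by (metis v power_mult mult.commute)
  have "pt k v ^ q = pt k (v ^ q)"
    by (simp add: pt_def power_divide add_pow_q shift_pow_q scale_pow_q power_inverse)
  also have "\<dots> = pt k ((N k)\<^sup>2 * v)"
  proof (cases "even m")
    case True
    define \<epsilon> where "\<epsilon> = v ^ q / v"
    have "\<epsilon> ^ 3 = 1"
      using vq True v by (simp add: \<epsilon>_def power_divide pow_q_cubes \<omega>_nz c_nz)
    then have \<epsilon>q: "\<epsilon> ^ q = \<epsilon>" and \<epsilon>4: "(\<epsilon>\<^sup>2)\<^sup>2 = \<epsilon>"
      using True by (simp_all add: pow_q_of_cube_root_of_unity power2_eq_square power3_eq_cube mult.assoc)
    have q1: "v ^ q = \<epsilon> * v"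
      using nz by (simp add: \<epsilon>_def)
    have "N k * v = (v ^ q) ^ q"
      using pow_q_square[OF v] by (simp add: power2_eq_square power_mult)
    also have "\<dots> = \<epsilon>\<^sup>2 * v"
      by (simp add: q1 power_mult_distrib \<epsilon>q power2_eq_square)
    finally have "N k = \<epsilon>\<^sup>2"
      using nz by simp
    then show ?thesis
      by (simp only: q1 \<epsilon>4)
  next
    case False
    define \<epsilon> where "\<epsilon> = v ^ q * v"
    have "(v ^ q) ^ 3 = inverse (\<omega> ^ k * c)"
      using vq False by (simp only: pow_q_cubes if_False)
    then have \<epsilon>3: "\<epsilon> ^ 3 = 1"
      by (simp add: \<epsilon>_def power_mult_distrib v \<omega>_nz c_nz field_simps)
    then have \<epsilon>q: "\<epsilon> ^ q = \<epsilon>\<^sup>2"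
      using False by (simp add: pow_q_of_cube_root_of_unity)
    have "\<epsilon> \<noteq> 0"
      using \<epsilon>3 by auto
    have q1: "v ^ q = \<epsilon> * inverse v"
      using nz by (simp add: \<epsilon>_def)
    have "N k * v = (v ^ q) ^ q"
      using pow_q_square[OF v] by (simp add: power2_eq_square power_mult)
    also have "\<dots> = \<epsilon>\<^sup>2 * inverse (\<epsilon> * inverse v)"
      by (simp only: q1 power_mult_distrib \<epsilon>q power_inverse)
    also have "\<dots> = \<epsilon> * v"
      using \<open>\<epsilon> \<noteq> 0\<close> by (simp add: power2_eq_square)
    finally have "N k = \<epsilon>"
      using nz by simp
    moreover have "inverse \<epsilon> = \<epsilon>\<^sup>2"
      using \<epsilon>3 by (intro inverse_unique) (simp add: power2_eq_square power3_eq_cube mult.assoc)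
    ultimately have "v ^ q = inverse ((N k)\<^sup>2 * v)"
      by (simp add: q1 flip: \<open>inverse \<epsilon> = \<epsilon>\<^sup>2\<close>)
    then show ?thesis
      by (simp only: pt_inverse)
  qed
  finally show ?thesis .
qed

lemma N_power_mult_cubed: "(N k ^ n * v) ^ 3 = v ^ 3"
proof -
  have "(N k ^ n) ^ 3 = (N k ^ 3) ^ n"
    by (simp add: mult.commute flip: power_mult)
  then show ?thesis
    by (simp only: power_mult_distrib N_cubed power_one mult_1_left)
qed

lemma pt_pow_q_pow:
  assumes v: "v ^ 3 = \<omega> ^ k * c"
  shows "pt k v ^ q ^ n = pt k (N k ^ (2 * n) * v)"
proof (induction n)
  case (Suc n)
  have "pt k v ^ q ^ Suc n = (pt k v ^ q ^ n) ^ q"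
    by (simp add: mult.commute flip: power_mult)
  also have "\<dots> = pt k ((N k)\<^sup>2 * (N k ^ (2 * n) * v))"
    unfolding Suc using v by (intro pt_pow_q) (simp add: N_power_mult_cubed)
  finally show ?case
    by (simp add: power2_eq_square mult_ac)
qed simp

section \<open>Which points of the three sets lie in \<open>Gamma\<close>\<close>

lemma trinomial_eq_0_iff: "x ^ (2 * n + 1) + x + a = 0 \<longleftrightarrow> x * (x ^ n + 1)\<^sup>2 = a"
proof -
  have "x ^ (2 * n + 1) = (x ^ n)\<^sup>2 * x"
    by (simp add: mult.commute flip: power_mult)
  then have "x ^ (2 * n + 1) + x + a = x * (x ^ n + 1)\<^sup>2 + a"
    using two by (simp add: power2_sum algebra_simps)
  then show ?thesis
    by (simp only: eq_iff_add[of _ a])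
qed

text \<open>With \<open>\<nu> = N k ^ l\<close>, the trinomial says that \<phi> maps
  \<open>pt k (\<nu>\<^sup>2 * v)\<close> back to \<open>pt k v\<close>, which by injectivity means
  \<open>\<omega> ^ (2 * k) * \<nu>\<^sup>2 = 1\<close>. The criterion is independent of
  \<open>v\<close>, so each \<open>pts k\<close> lies in \<open>Gamma\<close> as a whole or misses
  it.\<close>

lemma pt_in_Gamma_iff:
  assumes k: "k < 3" and v: "v ^ 3 = \<omega> ^ k * c"
  shows "pt k v \<in> Gamma q a l \<longleftrightarrow> N k ^ l = \<omega> ^ (2 * k)"
proof -
  define \<nu> where "\<nu> = N k ^ l"
  have cube: "(\<nu>\<^sup>2 * v) ^ 3 = \<omega> ^ k * c"
    unfolding \<nu>_def power_mult[symmetric] N_power_mult_cubed by (rule v)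
  have \<nu>: "\<nu> * \<nu>\<^sup>2 = 1"
    using N_power_mult_cubed[of k l 1]
    by (simp add: \<nu>_def power2_eq_square power3_eq_cube mult.assoc)
  have "N k ^ (2 * 3) = (N k ^ 3)\<^sup>2"
    by (simp flip: power_mult)
  then have "pt k v \<in> GF (q ^ 3)"
    using pt_pow_q_pow[OF v, of 3] by (simp add: GF_def N_cubed)
  moreover have pow: "pt k v ^ q ^ l = pt k (\<nu>\<^sup>2 * v)"
  proof -
    have "\<nu>\<^sup>2 = N k ^ (2 * l)"
      by (simp only: \<nu>_def power_mult[symmetric] mult.commute)
    then show ?thesis
      by (simp only: pt_pow_q_pow[OF v])
  qed
  ultimately have "pt k v \<in> Gamma q a l \<longleftrightarrow> pt k v * (pt k (\<nu>\<^sup>2 * v) + 1)\<^sup>2 = a"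
    by (simp only: Gamma_def trinomial_eq_0_iff mem_Collect_eq simp_thms)
  also have "\<dots> \<longleftrightarrow> pt k v = pt k (\<omega> ^ (2 * k) * (\<nu>\<^sup>2 * v))"
  proof -
    have "pt k (\<omega> ^ (2 * k) * (\<nu>\<^sup>2 * v)) * (pt k (\<nu>\<^sup>2 * v) + 1)\<^sup>2 = a"
      using cube by (rule pt_step[OF k])
    then show ?thesis
      using a(1) by (metis mult_right_cancel mult_zero_right)
  qed
  also have "\<dots> \<longleftrightarrow> v = \<omega> ^ (2 * k) * (\<nu>\<^sup>2 * v)"
    using v cube by (intro pt_eq_iff k) (simp_all only: \<omega>_power_mult_cubed)
  also have "\<dots> \<longleftrightarrow> \<omega> ^ (2 * k) * \<nu>\<^sup>2 = 1"
    using cubes_nz[OF v] by (auto simp flip: mult.assoc)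
  also have "\<dots> \<longleftrightarrow> \<nu> = \<omega> ^ (2 * k)"
  proof -
    have "\<nu>\<^sup>2 \<noteq> 0"
      using \<nu> by auto
    then have "\<omega> ^ (2 * k) * \<nu>\<^sup>2 = 1 \<longleftrightarrow> \<omega> ^ (2 * k) = \<nu>"
      using mult_right_cancel[of "\<nu>\<^sup>2" "\<omega> ^ (2 * k)" \<nu>] unfolding \<nu> by blast
    then show ?thesis
      by (metis (no_types))
  qed
  finally show ?thesis
    by (simp add: \<nu>_def)
qed

lemma Gamma_subset: "Gamma q a l \<subseteq> pts 0 \<union> pts 1 \<union> pts 2"
proof
  fix x assume x: "x \<in> Gamma q a l"
  \<comment> \<open>\<open>F\<close> is a ring endomorphism fixing \<open>a\<close>, so applying it
    to the equation for \<open>x\<close> yields those for \<open>F x\<close> and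
    \<open>F (F x)\<close>. Its third iterate is the \<open>l\<close>-th iterate of the q^3-power
    map, which fixes \<open>x\<close> and closes the cycle.\<close>
  define F where "F y = y ^ q ^ l" for y :: 'a
  have F_add: "F (y + z) = F y + F z" for y z
    unfolding F_def q power_mult[symmetric] by (rule add_power_2_power[OF two])
  have F_mult: "F (y * z) = F y * F z" for y z
    by (simp add: F_def power_mult_distrib)
  have F_sq: "F (y\<^sup>2) = (F y)\<^sup>2" for y
    by (simp add: power2_eq_square F_mult)
  have F1: "F 1 = 1"
    by (simp add: F_def)
  have Fa: "F a = a"
  proof -
    have "F b = b"
      unfolding F_def by (induction l) (simp_all add: power_mult b_pow_q)
    then have "F (inverse a) = inverse a"
      by (simp add: inverse_a F_add F_sq F1)
    then show ?thesis
      by (simp add: F_def power_inverse)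
  qed
  have F3: "F (F (F x)) = x"
  proof -
    have "F (F (F x)) = x ^ (q ^ 3) ^ l"
      by (simp add: F_def power3_eq_cube power_mult_distrib power_mult)
    also have "x ^ q ^ 3 = x"
      using x by (simp add: Gamma_def GF_def)
    then have "x ^ (q ^ 3) ^ l = x"
      by (induction l) (simp_all add: power_mult)
    finally show ?thesis .
  qed
  have 1: "x * (F x + 1)\<^sup>2 = a"
    using x by (simp only: Gamma_def F_def trinomial_eq_0_iff mem_Collect_eq)
  then have "F (x * (F x + 1)\<^sup>2) = F a"
    by simp
  then have 2: "F x * (F (F x) + 1)\<^sup>2 = a"
    by (simp only: F_mult F_sq F_add F1 Fa)
  then have "F (F x * (F (F x) + 1)\<^sup>2) = F a"
    by simp
  then have "F (F x) * (x + 1)\<^sup>2 = a"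
    by (simp only: F_mult F_sq F_add F1 Fa F3)
  with 1 2 show "x \<in> pts 0 \<union> pts 1 \<union> pts 2"
    using three_cycle_iff_pts by blast
qed

lemma Gamma_Int_pts:
  assumes "k < 3"
  shows "Gamma q a l \<inter> pts k = (if N k ^ l = \<omega> ^ (2 * k) then pts k else {})"
  using pt_in_Gamma_iff[OF assms] by (auto simp: pts_def)

lemma is_cube_in_iff: "is_cube_in (GF (q\<^sup>2)) (\<omega> ^ k * c) \<longleftrightarrow> N k = 1"
  using \<omega>_nz c_nz q_pos
  by (subst is_cube_in_GF_iff) (simp_all add: q_square_e N_def)

text \<open>Every cube root of \<open>\<omega> ^ k * c\<close> lies in the field of order q^6: the
  q^2-power map multiplies it by \<open>N k\<close>, whose cube is 1.\<close>

lemma Lambda_idx_eq_pts: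
  assumes "k < 3"
  shows "Lambda_idx q a \<omega> b k = pts k"
proof -
  have GF: "v \<in> GF (q ^ 6)" if "v ^ 3 = \<omega> ^ k * c" for v
  proof -
    have "v ^ (q\<^sup>2) ^ n = N k ^ n * v" for n
    proof (induction n)
      case (Suc n)
      have "v ^ (q\<^sup>2) ^ Suc n = (v ^ (q\<^sup>2) ^ n) ^ q\<^sup>2"
        by (simp add: mult.commute flip: power_mult)
      also have "\<dots> = N k * (N k ^ n * v)"
        unfolding Suc using that by (intro pow_q_square) (simp add: N_power_mult_cubed)
      finally show ?case by simp
    qed simp
    from this[of 3] show ?thesis
      by (simp add: GF_def N_cubed flip: power_mult)
  qed
  consider "k = 0" | "k = 1" | "k = 2"
    using assms by linarith
  then show ?thesis
    using GF by cases
      (auto simp: Lambda_idx_def Lambda0_def Lambda1_def Lambda2_def pts_def pt_def shift_def scale_def)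
qed

section \<open>Reduction to residues modulo 3\<close>

lemma c_power_e: obtains n where "n < 3" "c ^ e = \<omega> ^ n"
proof -
  have "(c ^ e) ^ 3 = 1"
    using N_cubed[of 0] by (simp add: N_def)
  then show ?thesis
    using that cube_root_of_unity by blast
qed

lemma N_eq_\<omega>_power:
  assumes "c ^ e = \<omega> ^ n"
  shows "N k = \<omega> ^ (k * m + n)"
proof -
  have "N k = \<omega> ^ (k * e + n)"
    by (simp add: N_def power_mult_distrib power_add assms flip: power_mult)
  moreover have "(k * e + n) mod 3 = (k * m + n) mod 3"
    by (metis e_mod mod_add_left_eq mod_mult_right_eq)
  ultimately show ?thesis
    by (simp add: \<omega>_power_eq_iff)
qed

lemma Gamma_eq:
  assumes "c ^ e = \<omega> ^ n"
  shows "Gamma q a l = (\<Union>k\<in>{0, 1, 2}. if (k * m + n) * l mod 3 = 2 * k mod 3 then pts k else {})"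
proof -
  have "Gamma q a l = (\<Union>k\<in>{0, 1, 2}. Gamma q a l \<inter> pts k)"
    using Gamma_subset[of l] by auto
  also have "\<dots> = (\<Union>k\<in>{0, 1, 2}. if (k * m + n) * l mod 3 = 2 * k mod 3 then pts k else {})"
  proof (rule SUP_cong[OF refl])
    fix k :: nat assume "k \<in> {0, 1, 2}"
    then have "k < 3" by auto
    show "Gamma q a l \<inter> pts k = (if (k * m + n) * l mod 3 = 2 * k mod 3 then pts k else {})"
      unfolding Gamma_Int_pts[OF \<open>k < 3\<close>] N_eq_\<omega>_power[OF assms] power_mult[symmetric] \<omega>_power_eq_iff ..
  qed
  finally show ?thesis .
qed

lemma is_cube_in_iff_mod:
  assumes "c ^ e = \<omega> ^ n"
  shows "is_cube_in (GF (q\<^sup>2)) (\<omega> ^ k * c) \<longleftrightarrow> (k * m + n) mod 3 = 0"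
  using \<omega>_power_eq_iff[of "k * m + n" 0] by (simp add: is_cube_in_iff N_eq_\<omega>_power[OF assms])

lemma c_power_eq_powi_iff:
  assumes "c ^ e = \<omega> ^ n"
  shows "c ^ e = \<omega> powi (- int j) \<longleftrightarrow> n mod 3 = 2 * j mod 3"
proof -
  have "(\<omega> ^ j) ^ 3 = 1"
    by (metis \<omega>_cubed power_mult mult.commute power_one)
  then have "inverse (\<omega> ^ j) = \<omega> ^ (2 * j)"
    by (intro inverse_unique) (simp add: power_mult mult.commute[of 2] power2_eq_square power3_eq_cube mult.assoc)
  then show ?thesis
    by (simp add: assms power_int_minus \<omega>_power_eq_iff)
qed

lemma Gamma_classification:
  assumes "\<not> 3 dvd l"
  shows "3 dvd m \<and> is_cube_in (GF (q\<^sup>2)) c \<longrightarrow> Gamma q a l = pts 0"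
    and "3 dvd m \<and> \<not> is_cube_in (GF (q\<^sup>2)) c \<longrightarrow>
          (\<exists>!k. k \<in> {1, 2} \<and> c ^ e = \<omega> powi (- int (k * l))) \<and>
          (\<forall>k \<in> {1, 2}. c ^ e = \<omega> powi (- int (k * l)) \<longrightarrow> Gamma q a l = pts k)"
    and "\<not> 3 dvd m \<longrightarrow>
          (\<exists>!k. k \<in> {0, 1, 2 :: nat} \<and> is_cube_in (GF (q\<^sup>2)) (\<omega> ^ k * c)) \<and>
          (\<forall>k \<in> {0, 1, 2}. is_cube_in (GF (q\<^sup>2)) (\<omega> ^ k * c) \<longrightarrow>
            (k = 0 \<and> [int l = int m] (mod 3) \<longrightarrow> Gamma q a l = pts 0) \<and>
            (k \<noteq> 0 \<and> [int l = int m] (mod 3) \<longrightarrow> Gamma q a l = pts (3 - k)) \<and>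
            (k = 0 \<and> [int l = - int m] (mod 3) \<longrightarrow> Gamma q a l = pts 0 \<union> pts 1 \<union> pts 2) \<and>
            (k \<noteq> 0 \<and> [int l = - int m] (mod 3) \<longrightarrow> Gamma q a l = {}))"
proof -
  obtain n where n: "n < 3" "c ^ e = \<omega> ^ n"
    by (rule c_power_e)
  define r s where "r = m mod 3" and "s = l mod 3"
  have lin: "(k * m + n) mod 3 = (k * r + n) mod 3" for k
    unfolding r_def by (metis mod_add_left_eq mod_mult_right_eq)
  then have "(k * m + n) * l mod 3 = (k * r + n) * s mod 3" for k
    unfolding s_def by (metis mod_mult_eq mod_mod_trivial)
  then have Gamma: "Gamma q a l = (\<Union>k\<in>{0, 1, 2}. if (k * r + n) * s mod 3 = 2 * k mod 3 then pts k else {})"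
    by (simp only: Gamma_eq[OF n(2)])
  have cube: "is_cube_in (GF (q\<^sup>2)) (\<omega> ^ k * c) \<longleftrightarrow> (k * r + n) mod 3 = 0" for k
    unfolding is_cube_in_iff_mod[OF n(2)] lin ..
  have cube0: "is_cube_in (GF (q\<^sup>2)) c \<longleftrightarrow> n mod 3 = 0"
    using cube[of 0] by simp
  have powi: "c ^ e = \<omega> powi (- int (k * l)) \<longleftrightarrow> n mod 3 = 2 * (k * s) mod 3" for k
    unfolding c_power_eq_powi_iff[OF n(2)] s_def by (metis mod_mult_right_eq)
  \<comment> \<open>Unique existence becomes bounded quantification, which simplification evaluates
    on an explicit finite set.\<close>
  have ex1: "(\<exists>!k. k \<in> K \<and> P k) \<longleftrightarrow> (\<exists>k\<in>K. P k) \<and> (\<forall>i\<in>K. \<forall>j\<in>K. P i \<longrightarrow> P j \<longrightarrow> i = j)"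
    for K :: "nat set" and P
    by blast
  have quantifiers: "(\<forall>k\<in>{0, 1, 2}. P k) \<longleftrightarrow> P 0 \<and> P 1 \<and> P 2"
    "(\<exists>k\<in>{0, 1, 2}. P k) \<longleftrightarrow> P 0 \<or> P 1 \<or> P 2" for P :: "nat \<Rightarrow> bool"
    by simp_all
  have cong: "[int l = int m] (mod 3) \<longleftrightarrow> s = r"
    using cong_int_iff[of l m 3] by (simp add: cong_def r_def s_def)
  have cong_minus: "[int l = - int m] (mod 3) \<longleftrightarrow> (s + r) mod 3 = 0"
  proof -
    have "[int l = - int m] (mod 3) \<longleftrightarrow> int 3 dvd int (l + m)"
      by (simp add: cong_iff_dvd_diff)
    also have "\<dots> \<longleftrightarrow> (l + m) mod 3 = 0"
      by (simp only: int_dvd_int_iff mod_eq_0_iff_dvd)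
    also have "(l + m) mod 3 = (s + r) mod 3"
      by (simp only: r_def s_def mod_add_eq)
    finally show ?thesis .
  qed
  have dvd: "3 dvd m \<longleftrightarrow> r = 0"
    by (auto simp: r_def)
  \<comment> \<open>All conditions now depend on \<open>r\<close>, \<open>s\<close> and
    \<open>n\<close> only; \<open>s = 0\<close> is excluded since 3 does not divide
    \<open>l\<close>, which leaves 18 cases.\<close>
  have cases: "r = 0 \<or> r = 1 \<or> r = 2" "s = 1 \<or> s = 2" "n = 0 \<or> n = 1 \<or> n = 2"
    using assms n(1) unfolding r_def s_def by presburger+
  show "3 dvd m \<and> is_cube_in (GF (q\<^sup>2)) c \<longrightarrow> Gamma q a l = pts 0"
    unfolding Gamma cube cube0 powi ex1 cong cong_minus dvd ball_simps bex_simps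
    using cases by (elim disjE; simp)
  show "3 dvd m \<and> \<not> is_cube_in (GF (q\<^sup>2)) c \<longrightarrow>
          (\<exists>!k. k \<in> {1, 2} \<and> c ^ e = \<omega> powi (- int (k * l))) \<and>
          (\<forall>k \<in> {1, 2}. c ^ e = \<omega> powi (- int (k * l)) \<longrightarrow> Gamma q a l = pts k)"
    unfolding Gamma cube cube0 powi ex1 cong cong_minus dvd ball_simps bex_simps
    using cases by (elim disjE; simp)
  show "\<not> 3 dvd m \<longrightarrow>
          (\<exists>!k. k \<in> {0, 1, 2 :: nat} \<and> is_cube_in (GF (q\<^sup>2)) (\<omega> ^ k * c)) \<and>
          (\<forall>k \<in> {0, 1, 2}. is_cube_in (GF (q\<^sup>2)) (\<omega> ^ k * c) \<longrightarrow>
            (k = 0 \<and> [int l = int m] (mod 3) \<longrightarrow> Gamma q a l = pts 0) \<and>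
            (k \<noteq> 0 \<and> [int l = int m] (mod 3) \<longrightarrow> Gamma q a l = pts (3 - k)) \<and>
            (k = 0 \<and> [int l = - int m] (mod 3) \<longrightarrow> Gamma q a l = pts 0 \<union> pts 1 \<union> pts 2) \<and>
            (k \<noteq> 0 \<and> [int l = - int m] (mod 3) \<longrightarrow> Gamma q a l = {}))"
    unfolding Gamma cube cube0 powi ex1 cong cong_minus dvd quantifiers
    using cases by (elim disjE; simp add: Un_assoc)
qed

end

section \<open>Existence of \<open>\<omega>\<close> and \<open>b\<close>, and assembly of the
  result\<close>

theorem theorem1p3:
  fixes l m q :: nat and a :: F2bar
  assumes "l > 0" and "m > 0" and "\<not> 3 dvd l"
    and "q = 2 ^ m"
    and "a \<in> GF q - GF 2"
    and "Tr m (inverse a) = Tr m 1"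
  shows "(\<exists>\<omega>. \<omega> \<in> GF 4 - (GF 2 :: F2bar set)) \<and>
    (\<exists>b \<in> GF q. b\<^sup>2 + b = inverse a + 1) \<and>
    (\<forall>\<omega> \<in> GF 4 - GF 2. \<forall>b \<in> GF q. b\<^sup>2 + b = inverse a + 1 \<longrightarrow>
      b \<notin> GF 4 \<and>
      (let c = cpar \<omega> b;
           \<Gamma> = Gamma q a l;
           \<Lambda> = Lambda_idx q a \<omega> b
       in
        (\<forall>i \<in> {0, 1, 2}. card (\<Lambda> i) = 3) \<and>
        (\<forall>i \<in> {0, 1, 2}. \<forall>j \<in> {0, 1, 2}. i \<noteq> j \<longrightarrow> \<Lambda> i \<inter> \<Lambda> j = {}) \<and>
        (3 dvd m \<and> is_cube_in (GF (q\<^sup>2)) c \<longrightarrow> \<Gamma> = \<Lambda> 0) \<and>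
        (3 dvd m \<and> \<not> is_cube_in (GF (q\<^sup>2)) c \<longrightarrow>
          (\<exists>!k. k \<in> {1, 2} \<and> c ^ ((q\<^sup>2 - 1) div 3) = \<omega> powi (- int (k * l))) \<and>
          (\<forall>k \<in> {1, 2}. c ^ ((q\<^sup>2 - 1) div 3) = \<omega> powi (- int (k * l)) \<longrightarrow> \<Gamma> = \<Lambda> k)) \<and>
        (\<not> 3 dvd m \<longrightarrow>
          (\<exists>!k. k \<in> {0, 1, 2 :: nat} \<and> is_cube_in (GF (q\<^sup>2)) (\<omega> ^ k * c)) \<and>
          (\<forall>k \<in> {0, 1, 2}. is_cube_in (GF (q\<^sup>2)) (\<omega> ^ k * c) \<longrightarrow>
            (k = 0 \<and> [int l = int m] (mod 3) \<longrightarrow> \<Gamma> = \<Lambda> 0) \<and>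
            (k \<noteq> 0 \<and> [int l = int m] (mod 3) \<longrightarrow> \<Gamma> = \<Lambda> (3 - k)) \<and>
            (k = 0 \<and> [int l = - int m] (mod 3) \<longrightarrow> \<Gamma> = \<Lambda> 0 \<union> \<Lambda> 1 \<union> \<Lambda> 2) \<and>
            (k \<noteq> 0 \<and> [int l = - int m] (mod 3) \<longrightarrow> \<Gamma> = {})))))"
proof (intro conjI ballI impI)
  have two: "(2 :: F2bar) = 0"
    using of_nat_CHAR[where 'a = F2bar] by simp
  have a: "a \<noteq> 0" "a \<noteq> 1"
    using assms(5) by (auto simp: GF_def)
  obtain \<omega> :: F2bar where "\<omega>\<^sup>2 + \<omega> = 1"
    by (rule exists_artin_schreier)
  then have "\<omega>\<^sup>2 + \<omega> + 1 = 0"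
    using two by simp
  then show "\<exists>\<omega>. \<omega> \<in> GF 4 - (GF 2 :: F2bar set)"
    using GF4_minus_GF2_iff[OF two] by blast
  \<comment> \<open>The trace condition on \<open>a\<close> says exactly that the equation for
    \<open>b\<close> is solvable in the field of order \<open>q\<close>.\<close>
  have "Tr m (inverse a + 1) = 2 * Tr m 1"
    by (simp add: Tr_add[OF two] assms(6))
  then have "Tr m (inverse a + 1) = 0"
    using two by simp
  then show "\<exists>b \<in> GF q. b\<^sup>2 + b = inverse a + 1"
    unfolding assms(4) using exists_artin_schreier_GF[OF two] by metis
  fix \<omega> b :: F2bar
  assume "\<omega> \<in> GF 4 - GF 2" and "b \<in> GF q" and b: "b\<^sup>2 + b = inverse a + 1"
  then have \<omega>: "\<omega>\<^sup>2 + \<omega> + 1 = 0" and bq: "b ^ q = b"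
    using GF4_minus_GF2_iff[OF two] by (auto simp: GF_def)
  interpret char2_frobenius a b \<omega> m q
    using two a \<omega> b assms(4) bq by unfold_locales
  \<comment> \<open>Elements of \<open>GF 4\<close> outside \<open>GF 2\<close> are the roots of X^2
    + X + 1, whereas \<open>b\<^sup>2 + b + 1\<close> is 1/a.\<close>
  have "b \<notin> GF 2"
    using b_neq by (auto simp: GF_def power2_eq_square)
  moreover have "b\<^sup>2 + b + 1 \<noteq> 0"
    using a_mult by auto
  ultimately show "b \<notin> GF 4"
    using GF4_minus_GF2_iff[OF two, of b] by blast
  show "let c = cpar \<omega> b;
           \<Gamma> = Gamma q a l;
           \<Lambda> = Lambda_idx q a \<omega> b
       in
        (\<forall>i \<in> {0, 1, 2}. card (\<Lambda> i) = 3) \<and>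
        (\<forall>i \<in> {0, 1, 2}. \<forall>j \<in> {0, 1, 2}. i \<noteq> j \<longrightarrow> \<Lambda> i \<inter> \<Lambda> j = {}) \<and>
        (3 dvd m \<and> is_cube_in (GF (q\<^sup>2)) c \<longrightarrow> \<Gamma> = \<Lambda> 0) \<and>
        (3 dvd m \<and> \<not> is_cube_in (GF (q\<^sup>2)) c \<longrightarrow>
          (\<exists>!k. k \<in> {1, 2} \<and> c ^ ((q\<^sup>2 - 1) div 3) = \<omega> powi (- int (k * l))) \<and>
          (\<forall>k \<in> {1, 2}. c ^ ((q\<^sup>2 - 1) div 3) = \<omega> powi (- int (k * l)) \<longrightarrow> \<Gamma> = \<Lambda> k)) \<and>
        (\<not> 3 dvd m \<longrightarrow>
          (\<exists>!k. k \<in> {0, 1, 2 :: nat} \<and> is_cube_in (GF (q\<^sup>2)) (\<omega> ^ k * c)) \<and>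
          (\<forall>k \<in> {0, 1, 2}. is_cube_in (GF (q\<^sup>2)) (\<omega> ^ k * c) \<longrightarrow>
            (k = 0 \<and> [int l = int m] (mod 3) \<longrightarrow> \<Gamma> = \<Lambda> 0) \<and>
            (k \<noteq> 0 \<and> [int l = int m] (mod 3) \<longrightarrow> \<Gamma> = \<Lambda> (3 - k)) \<and>
            (k = 0 \<and> [int l = - int m] (mod 3) \<longrightarrow> \<Gamma> = \<Lambda> 0 \<union> \<Lambda> 1 \<union> \<Lambda> 2) \<and>
            (k \<noteq> 0 \<and> [int l = - int m] (mod 3) \<longrightarrow> \<Gamma> = {})))"
    unfolding Let_def e_def[symmetric]
  proof (intro conjI)
    show "\<forall>i\<in>{0, 1, 2}. card (Lambda_idx q a \<omega> b i) = 3"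
      by (auto simp: Lambda_idx_eq_pts card_pts)
    show "\<forall>i\<in>{0, 1, 2}. \<forall>j\<in>{0, 1, 2}. i \<noteq> j \<longrightarrow> Lambda_idx q a \<omega> b i \<inter> Lambda_idx q a \<omega> b j = {}"
      using pts_disjoint by (simp add: Lambda_idx_eq_pts)
  qed (use Gamma_classification[OF assms(3)] in \<open>simp_all add: Lambda_idx_eq_pts\<close>)
qed

end
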